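(* Let $n\ge 1$ and let $\mathscr A$ be a symmetric orientation of $\Gamma_{2n-1}$. Then the center of gravity of the cyclohedron $\mathrm{Asso}_{\mathscr A}(W_n)\subset\mathbb R^{2n}$ is $G=\left(\frac{2n+1}{2},\frac{2n+1}{2},\dots,\frac{2n+1}{2}\right)\in\mathbb R^{2n}$; that is, $\sum_{T\in\mathcal T^B_{2n+2}}\left(M_{\mathscr A}(T)-G\right)=0$.
   Context: Write $[m]=\{1,\dots,m\}$. Let $P$ be a regular $(2n+2)$-gon in the Euclidean plane with vertices $A_0,A_1,\dots,A_{2n+1}$ in counterclockwise order. A triangle of $P$ is a triangle whose vertices are vertices of $P$ (so each of its sides is an edge or a diagonal of $P$). A triangulation $T$ of $P$ is a collection of $2n$ distinct triangles of $P$ with pairwise noncrossing sides (equivalently, a set of $2n-1$ pairwise noncrossing diagonals cutting $P$ into $2n$ triangles). $\mathcal T_{2n+2}$ is the set of all triangulations of $P$, and $\mathcal T^B_{2n+2}\subseteq\mathcal T_{2n+2}$ is the set of centrally symmetric ones, i.e. those invariant under the rotation by $\pi$ about the center of $P$. The Coxeter graph $\Gamma_{2n-1}$ of $S_{2n}$ is the path with vertices $\tau_1,\dots,\tau_{2n-1}$ (the simple transpositions $\tau_i=(i,\,i+1)$) and edges $\{\tau_i,\tau_{i+1}\}$, $i\in[2n-2]$. An orientation $\mathscr A$ of $\Gamma_{2n-1}$ is symmetric if for all $i\in[2n-2]$ the edges $\{\tau_i,\tau_{i+1}\}$ and $\{\tau_{2n-i-1},\tau_{2n-i}\}$ are oriented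 in opposite directions (exactly one of the two is directed from its smaller-index to its larger-index endpoint). An element $i\in\{2,\dots,2n-1\}$ is up if the edge $\{\tau_{i-1},\tau_i\}$ is directed from $\tau_i$ to $\tau_{i-1}$, and down otherwise; $1$ and $2n$ are set to be down. Let $\mathsf D_{\mathscr A}$ and $\mathsf U_{\mathscr A}$ be the sets of down and up elements of $[2n]$. Label the vertices of $P$ by $0,1,\dots,2n+1$ as follows: $A_0$ is labeled $0$, and then, going counterclockwise from $A_0$, the vertices are labeled by the down elements in increasing order, then by $2n+1$, then by the up elements in decreasing order. For $l\in[2n]$ and $T\in\mathcal T_{2n+2}$ there is a unique triangle $\Delta_l^{\mathscr A}(T)$ of $T$ whose vertices are labeled $k<l<m$. Its weight $\omega_l^{\mathscr A}(T)$ is the product of the number of edges of the boundary path of $P$ from the vertex labeled $l$ to the vertex labeled $k$ passing only through vertices labeled by numbers $\le l$, and the number of edges of the boundary path of $P$ from the vertex labeled $l$ to the vertex labeled $m$ passing only through vertices labeled by numbers $\ge l$. Set $x_j^{\mathscr A}(T)=\omega_j^{\mathscr A}(T)$ if $j\in\mathsf D_{\mathscr A}$ and $x_j^{\mathscr A}(T)=2n+1-\omega_j^{\mathscr A}(T)$ if $j\in\mathsf U_{\mathscr A}$, and $M_{\mathscr A}(T)=(x_1^{\mathscr A}(T),\dots,x_{2n}^{\mathscr A}(T))\in\mathbb R^{2n}$. The map $M_{\mathscr A}$ is injective. $\mathrm{Asso}_{\mathscr A}(W_n)$ (where $W_n$ is the hyperoctahedral group) is the convex hull of $\{M_{\mathscr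 A}(T)\mid T\in\mathcal T^B_{2n+2}\}$; it is a realization of the cyclohedron, and these points are its vertices. The center of gravity (isobarycenter) of this polytope is the isobarycenter of its vertices, i.e. the unique point $G\in\mathbb R^{2n}$ with $\sum_{T\in\mathcal T^B_{2n+2}}(M_{\mathscr A}(T)-G)=0$. *)

theory Defs
  imports "HOL-Analysis.Analysis"
begin

section \<open>Orientations of the Coxeter graph of the symmetric group\<close>

text \<open>
  The vertex \<open>\<tau>\<^sub>i\<close> of the path \<open>\<Gamma>\<close> with vertices \<open>\<tau>\<^sub>1, \<dots>, \<tau>\<^sub>2\<^sub>n\<^sub>-\<^sub>1\<close> is represented by \<open>i\<close>, and an
  orientation by its set of arcs: \<open>(i, j)\<close> is the edge directed from \<open>\<tau>\<^sub>i\<close> to \<open>\<tau>\<^sub>j\<close>.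
\<close>

definition coxeter_orientation :: "nat \<Rightarrow> (nat \<times> nat) set \<Rightarrow> bool" where
  "coxeter_orientation n E \<longleftrightarrow>
     E \<subseteq> (\<Union>i\<in>{1..2*n-2}. {(i, i+1), (i+1, i)}) \<and>
     (\<forall>i\<in>{1..2*n-2}. (i, i+1) \<in> E \<longleftrightarrow> (i+1, i) \<notin> E)"

definition symmetric_orientation :: "nat \<Rightarrow> (nat \<times> nat) set \<Rightarrow> bool" where
  "symmetric_orientation n E \<longleftrightarrow> coxeter_orientation n E \<and>
     (\<forall>i\<in>{1..2*n-2}. (i, i+1) \<in> E \<longleftrightarrow> (2*n-i-1, 2*n-i) \<notin> E)"

definition up_elements :: "nat \<Rightarrow> (nat \<times> nat) set \<Rightarrow> nat set" where
  "up_elements n E = {i \<in> {2..2*n-1}. (i, i-1) \<in> E}"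

definition down_elements :: "nat \<Rightarrow> (nat \<times> nat) set \<Rightarrow> nat set" where
  "down_elements n E = {1..2*n} - up_elements n E"


section \<open>Triangulations of a regular polygon\<close>

text \<open>
  The vertex \<open>A\<^sub>p\<close> of the regular \<open>N\<close>-gon is represented by \<open>p < N\<close>. Since the vertices lie on a
  circle in this cyclic order, two chords cross (meet in a point interior to both) iff their
  endpoints strictly alternate.
\<close>

definition crossing :: "nat set \<Rightarrow> nat set \<Rightarrow> bool" where
  "crossing e f \<longleftrightarrow> (\<exists>a b c d. a < b \<and> b < c \<and> c < d \<and>
     (e = {a, c} \<and> f = {b, d} \<or> e = {b, d} \<and> f = {a, c}))"

definition polygon_triangles :: "nat \<Rightarrow> nat set set" where
  "polygon_triangles N = {t. t \<subseteq> {..<N} \<and> card t = 3}"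

definition sides :: "nat set \<Rightarrow> nat set set" where
  "sides t = {e. e \<subseteq> t \<and> card e = 2}"

definition triangulations :: "nat \<Rightarrow> nat set set set" where
  "triangulations N = {T. T \<subseteq> polygon_triangles N \<and> card T = N - 2 \<and>
     (\<forall>t\<in>T. \<forall>t'\<in>T. \<forall>e\<in>sides t. \<forall>f\<in>sides t'. \<not> crossing e f)}"

definition half_turn :: "nat \<Rightarrow> nat \<Rightarrow> nat" where
  "half_turn n p = (p + (n + 1)) mod (2*n+2)"

definition symmetric_triangulations :: "nat \<Rightarrow> nat set set set" where
  "symmetric_triangulations n =
     {T \<in> triangulations (2*n+2). (\<lambda>t. half_turn n ` t) ` T = T}"


section \<open>Labels and weights\<close>

definition vertex_label :: "nat \<Rightarrow> (nat \<times> nat) set \<Rightarrow> nat \<Rightarrow> nat" where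
  "vertex_label n E p =
     (0 # sorted_list_of_set (down_elements n E) @
      (2*n+1) # rev (sorted_list_of_set (up_elements n E))) ! p"

definition vertex_at :: "nat \<Rightarrow> (nat \<times> nat) set \<Rightarrow> nat \<Rightarrow> nat" where
  "vertex_at n E l = (THE p. p < 2*n+2 \<and> vertex_label n E p = l)"

text \<open>\<open>ccw_path N p q\<close> lists the vertices met when going counterclockwise from \<open>p\<close> to \<open>q\<close>.\<close>

definition ccw_path :: "nat \<Rightarrow> nat \<Rightarrow> nat \<Rightarrow> nat list" where
  "ccw_path N p q = map (\<lambda>s. (p + s) mod N) [0..<Suc ((q + N - p) mod N)]"

definition boundary_paths :: "nat \<Rightarrow> nat \<Rightarrow> nat \<Rightarrow> nat list set" where
  "boundary_paths N p q = {ccw_path N p q, rev (ccw_path N q p)}"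

text \<open>
  Number of edges of the boundary path joining the vertices labeled \<open>l\<close> and \<open>k\<close> all of whose
  vertices have a label in \<open>L\<close>.
\<close>

definition path_edges :: "nat \<Rightarrow> (nat \<times> nat) set \<Rightarrow> nat set \<Rightarrow> nat \<Rightarrow> nat \<Rightarrow> nat" where
  "path_edges n E L l k =
     length (THE \<pi>. \<pi> \<in> boundary_paths (2*n+2) (vertex_at n E l) (vertex_at n E k) \<and>
                    vertex_label n E ` set \<pi> \<subseteq> L) - 1"

text \<open>The labels \<open>(k, m)\<close> of the two other vertices of the triangle of \<open>T\<close> with middle label \<open>l\<close>.\<close>

definition middle_triangle :: "nat \<Rightarrow> (nat \<times> nat) set \<Rightarrow> nat set set \<Rightarrow> nat \<Rightarrow> nat \<times> nat" where
  "middle_triangle n E T l =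
     (THE (k, m). k < l \<and> l < m \<and> (\<exists>t\<in>T. vertex_label n E ` t = {k, l, m}))"

definition weight :: "nat \<Rightarrow> (nat \<times> nat) set \<Rightarrow> nat set set \<Rightarrow> nat \<Rightarrow> nat" where
  "weight n E T l = (case middle_triangle n E T l of (k, m) \<Rightarrow>
     path_edges n E {..l} l k * path_edges n E {l..} l m)"


section \<open>The cyclohedron and its center of gravity\<close>

definition coordinate :: "nat \<Rightarrow> (nat \<times> nat) set \<Rightarrow> nat set set \<Rightarrow> nat \<Rightarrow> real" where
  "coordinate n E T j =
     (if j \<in> up_elements n E then 2 * real n + 1 - real (weight n E T j)
      else real (weight n E T j))"

text \<open>
  The space \<open>\<real>\<^sup>2\<^sup>n\<close> is rendered as \<open>real ^ 'm\<close>, where the bijection \<open>\<iota>\<close> from the index type \<open>'m\<close> onto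
  \<open>{1..2*n}\<close> numbers the coordinates.
\<close>

definition M :: "nat \<Rightarrow> (nat \<times> nat) set \<Rightarrow> ('m::finite \<Rightarrow> nat) \<Rightarrow> nat set set \<Rightarrow> real ^ 'm" where
  "M n E \<iota> T = (\<chi> i. coordinate n E T (\<iota> i))"

text \<open>
  The cyclohedron is the convex hull of the points \<open>M n E \<iota> T\<close> for \<open>T \<in> symmetric_triangulations n\<close>,
  which are its vertices and are pairwise distinct. Its center of gravity is the isobarycenter of
  these vertices.
\<close>

definition cyclohedron_center :: "nat \<Rightarrow> (nat \<times> nat) set \<Rightarrow> ('m::finite \<Rightarrow> nat) \<Rightarrow> real ^ 'm" where
  "cyclohedron_center n E \<iota> =
     (THE G. (\<Sum>T\<in>symmetric_triangulations n. M n E \<iota> T - G) = 0)"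

end

theory Submission
  imports Defs
begin

text \<open>
  Put the vertex labeled \<open>l\<close> at position \<open>0\<close> by a rotation of the \<open>N\<close>-gon, \<open>N = 2 * n + 2\<close>. The labels
  first increase and then decrease along the boundary, so the labels above \<open>l\<close>, or those below \<open>l\<close>,
  occupy an initial segment \<open>1, \<dots>, s\<close> of the remaining positions, and the weight of \<open>l\<close> is \<open>b * (N - c)\<close> where
  \<open>{0, b, c}\<close> is the unique triangle with \<open>b \<le> s < c\<close> (\<open>weight_eq_fan_product\<close>). The rotation
  permutes the centrally symmetric triangulations, so the orientation enters the sum of the
  weights only through the number \<open>s\<close>.

  It remains to see that the mean of \<open>b * (N - c)\<close> over all centrally symmetric triangulations is
  \<open>(N - 1) / 2\<close> for every \<open>s\<close> (\<open>sum_fan_product\<close>). The products for \<open>s - 1\<close> and \<open>s\<close> differ only if the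
  chord from \<open>0\<close> to \<open>s\<close> is present, and their difference changes sign under the reflection which
  exchanges the endpoints of this chord (\<open>fan_product_step_reflect\<close>). This reflection permutes the
  triangulations in question, so the mean does not depend on \<open>s\<close>. For \<open>s = 1\<close> the product is
  \<open>N - c\<close>, where \<open>c\<close> is the apex of the triangle on the edge from \<open>0\<close> to \<open>1\<close>, and the reflection
  exchanging \<open>0\<close> and \<open>1\<close> turns it into \<open>c - 1\<close> (\<open>fan_product_first_reflect\<close>).

  Since \<open>(N - 1) / 2\<close> is half of \<open>2 * n + 1\<close>, the coordinates of up elements have the same mean as
  those of down elements.
\<close>

section \<open>Symmetries of the polygon\<close>

definition rotation :: "nat \<Rightarrow> nat \<Rightarrow> nat \<Rightarrow> nat" where
  "rotation N r x = (x + r) mod N"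

definition reflection :: "nat \<Rightarrow> nat \<Rightarrow> nat \<Rightarrow> nat" where
  "reflection N s x = (s + (N - x)) mod N"

text \<open>
  Triangulations are described by crossings alone, so a permutation of the vertices that
  preserves crossings permutes the triangulations.
\<close>

definition polygon_symmetry :: "nat \<Rightarrow> (nat \<Rightarrow> nat) \<Rightarrow> bool" where
  "polygon_symmetry N \<sigma> \<longleftrightarrow> bij_betw \<sigma> {..<N} {..<N} \<and>
     (\<forall>e f. e \<subseteq> {..<N} \<longrightarrow> f \<subseteq> {..<N} \<longrightarrow> crossing (\<sigma> ` e) (\<sigma> ` f) = crossing e f)"

abbreviation move :: "(nat \<Rightarrow> nat) \<Rightarrow> nat set set \<Rightarrow> nat set set" where
  "move \<sigma> T \<equiv> (\<lambda>t. \<sigma> ` t) ` T"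

lemma crossing_commute: "crossing e f \<longleftrightarrow> crossing f e"
  unfolding crossing_def by blast

lemma crossing_pairs: "a < b \<Longrightarrow> b < c \<Longrightarrow> c < d \<Longrightarrow> crossing {a, c} {b, d}"
  unfolding crossing_def by blast

lemma polygon_symmetryI:
  assumes maps: "\<And>x. x < N \<Longrightarrow> \<sigma> x < N" "\<And>x. x < N \<Longrightarrow> \<tau> x < N"
    and inv: "\<And>x. x < N \<Longrightarrow> \<tau> (\<sigma> x) = x" "\<And>x. x < N \<Longrightarrow> \<sigma> (\<tau> x) = x"
    and cr: "\<And>a b c d. a < b \<Longrightarrow> b < c \<Longrightarrow> c < d \<Longrightarrow> d < N \<Longrightarrow> crossing {\<sigma> a, \<sigma> c} {\<sigma> b, \<sigma> d}"
      "\<And>a b c d. a < b \<Longrightarrow> b < c \<Longrightarrow> c < d \<Longrightarrow> d < N \<Longrightarrow> crossing {\<tau> a, \<tau> c} {\<tau> b, \<tau> d}"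
  shows "polygon_symmetry N \<sigma>"
proof -
  have bij: "bij_betw \<sigma> {..<N} {..<N}"
    by (rule bij_betw_byWitness[where f' = \<tau>]) (use maps inv in auto)
  have image: "crossing (\<rho> ` e) (\<rho> ` f)"
    if "crossing e f" "e \<subseteq> {..<N}" "f \<subseteq> {..<N}"
      and "\<And>a b c d. a < b \<Longrightarrow> b < c \<Longrightarrow> c < d \<Longrightarrow> d < N \<Longrightarrow> crossing {\<rho> a, \<rho> c} {\<rho> b, \<rho> d}"
    for \<rho> e f
    using that crossing_commute unfolding crossing_def[of e f]
    by (elim exE conjE disjE) auto
  have "crossing (\<sigma> ` e) (\<sigma> ` f) = crossing e f" if "e \<subseteq> {..<N}" "f \<subseteq> {..<N}" for e f
  proof
    assume "crossing e f"
    then show "crossing (\<sigma> ` e) (\<sigma> ` f)" using image cr(1) that by blast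
  next
    assume a: "crossing (\<sigma> ` e) (\<sigma> ` f)"
    have "\<sigma> ` e \<subseteq> {..<N}" "\<sigma> ` f \<subseteq> {..<N}" using that maps by auto
    then have "crossing (\<tau> ` \<sigma> ` e) (\<tau> ` \<sigma> ` f)" using image[OF a] cr(2) by blast
    moreover have "\<tau> ` \<sigma> ` e = e" "\<tau> ` \<sigma> ` f = f" using that inv(1) by (force simp: image_image)+
    ultimately show "crossing e f" by simp
  qed
  then show ?thesis using bij unfolding polygon_symmetry_def by blast
qed

lemma rotation_eq: "x < N \<Longrightarrow> r \<le> N \<Longrightarrow> rotation N r x = (if x + r < N then x + r else x + r - N)"
  unfolding rotation_def by (auto simp: mod_if)

lemma reflection_eq: "x < N \<Longrightarrow> s < N \<Longrightarrow> reflection N s x = (if x \<le> s then s - x else N + s - x)"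
  unfolding reflection_def by (auto simp: mod_if)

lemma rotation_inverse: "x < N \<Longrightarrow> r \<le> N \<Longrightarrow> rotation N (N - r) (rotation N r x) = x"
  unfolding rotation_def by (auto simp: mod_if)

text \<open>
  The cases say how many of the four points wrap around; each time their images are listed in
  increasing order.
\<close>

lemma rotation_crossing:
  assumes "a < b" "b < c" "c < d" "d < N" "r \<le> N"
  shows "crossing {rotation N r a, rotation N r c} {rotation N r b, rotation N r d}"
proof -
  consider "d + r < N" | "d + r \<ge> N" "c + r < N" | "c + r \<ge> N" "b + r < N"
    | "b + r \<ge> N" "a + r < N" | "a + r \<ge> N" by linarith
  then show ?thesis
  proof cases
    case 1
    then show ?thesis using assms by (simp add: rotation_eq crossing_pairs)
  next
    case 2
    then have "crossing {d + r - N, b + r} {a + r, c + r}"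
      using assms by (intro crossing_pairs) auto
    then show ?thesis using assms 2 by (simp add: rotation_eq crossing_commute insert_commute)
  next
    case 3
    then have "crossing {c + r - N, a + r} {d + r - N, b + r}"
      using assms by (intro crossing_pairs) auto
    then show ?thesis using assms 3 by (simp add: rotation_eq insert_commute)
  next
    case 4
    then have "crossing {b + r - N, d + r - N} {c + r - N, a + r}"
      using assms by (intro crossing_pairs) auto
    then show ?thesis using assms 4 by (simp add: rotation_eq crossing_commute insert_commute)
  next
    case 5
    then have "crossing {a + r - N, c + r - N} {b + r - N, d + r - N}"
      using assms by (intro crossing_pairs) auto
    then show ?thesis using assms 5 by (simp add: rotation_eq)
  qed
qed

lemma reflection_crossing:
  assumes "a < b" "b < c" "c < d" "d < N" "s < N"
  shows "crossing {reflection N s a, reflection N s c} {reflection N s b, reflection N s d}"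
proof -
  consider "d \<le> s" | "d > s" "c \<le> s" | "c > s" "b \<le> s"
    | "b > s" "a \<le> s" | "a > s" by linarith
  then show ?thesis
  proof cases
    case 1
    then have "crossing {s - d, s - b} {s - c, s - a}"
      using assms by (intro crossing_pairs) auto
    then show ?thesis using assms 1 by (simp add: reflection_eq crossing_commute insert_commute)
  next
    case 2
    then have "crossing {s - c, s - a} {s - b, N + s - d}"
      using assms by (intro crossing_pairs) auto
    then show ?thesis using assms 2 by (simp add: reflection_eq insert_commute)
  next
    case 3
    then have "crossing {s - b, N + s - d} {s - a, N + s - c}"
      using assms by (intro crossing_pairs) auto
    then show ?thesis using assms 3 by (simp add: reflection_eq crossing_commute insert_commute)
  next
    case 4
    then have "crossing {s - a, N + s - c} {N + s - d, N + s - b}"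
      using assms by (intro crossing_pairs) auto
    then show ?thesis using assms 4 by (simp add: reflection_eq insert_commute)
  next
    case 5
    then have "crossing {N + s - d, N + s - b} {N + s - c, N + s - a}"
      using assms by (intro crossing_pairs) auto
    then show ?thesis using assms 5 by (simp add: reflection_eq crossing_commute insert_commute)
  qed
qed

lemma polygon_symmetry_rotation:
  assumes "r \<le> N" shows "polygon_symmetry N (rotation N r)"
proof (rule polygon_symmetryI[where \<tau> = "rotation N (N - r)"])
  show "rotation N r (rotation N (N - r) x) = x" if "x < N" for x
    using rotation_inverse[OF that, of "N - r"] assms by simp
qed (use assms in \<open>auto simp: rotation_inverse rotation_crossing, auto simp: rotation_def\<close>)

lemma polygon_symmetry_reflection:
  assumes "s < N" shows "polygon_symmetry N (reflection N s)"
proof (rule polygon_symmetryI[where \<tau> = "reflection N s"])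
  show "reflection N s (reflection N s x) = x" if "x < N" for x
    using assms that by (auto simp: reflection_eq)
  then show "x < N \<Longrightarrow> reflection N s (reflection N s x) = x" for x .
qed (use assms in \<open>auto simp: reflection_crossing, auto simp: reflection_def\<close>)


section \<open>Triangulations and their images\<close>

lemma triangulation_subset:
  assumes "T \<in> triangulations N" "t \<in> T" shows "t \<subseteq> {..<N}"
  using assms unfolding triangulations_def polygon_triangles_def by blast

lemma triangulation_card3:
  assumes "T \<in> triangulations N" "t \<in> T" shows "card t = 3"
  using assms unfolding triangulations_def polygon_triangles_def by blast

lemma triangulation_noncrossing:
  assumes "T \<in> triangulations N" "t \<in> T" "t' \<in> T" "{a, c} \<subseteq> t" "{b, d} \<subseteq> t'"
    "a < b" "b < c" "c < d"
  shows False
proof -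
  have "{a, c} \<in> sides t" "{b, d} \<in> sides t'"
    using assms unfolding sides_def by auto
  then show False
    using crossing_pairs[OF assms(6-8)] assms(1-3) unfolding triangulations_def by blast
qed

lemma inj_on_move:
  assumes "polygon_symmetry N \<sigma>" shows "inj_on (move \<sigma>) (Pow (Pow {..<N}))"
  using assms unfolding polygon_symmetry_def bij_betw_def
  by (metis inj_on_image_Pow)

lemma move_triangulation:
  assumes \<sigma>: "polygon_symmetry N \<sigma>" and T: "T \<in> triangulations N"
  shows "move \<sigma> T \<in> triangulations N"
proof -
  have inj: "inj_on \<sigma> {..<N}" and im: "\<sigma> ` {..<N} = {..<N}"
    and cr: "\<And>e f. e \<subseteq> {..<N} \<Longrightarrow> f \<subseteq> {..<N} \<Longrightarrow> crossing (\<sigma> ` e) (\<sigma> ` f) = crossing e f"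
    using \<sigma> unfolding polygon_symmetry_def bij_betw_def by auto
  have sub: "T \<subseteq> Pow {..<N}" using triangulation_subset[OF T] by blast
  have "card (move \<sigma> T) = card T"
    using inj_on_subset[OF inj_on_image_Pow[OF inj] sub] by (rule card_image)
  moreover have "move \<sigma> T \<subseteq> polygon_triangles N"
  proof
    fix u assume "u \<in> move \<sigma> T"
    then obtain t where t: "t \<in> T" "u = \<sigma> ` t" by blast
    have "t \<subseteq> {..<N}" using triangulation_subset[OF T t(1)] .
    then have "card u = card t" "u \<subseteq> {..<N}"
      using t inj im card_image inj_on_subset by blast+
    then show "u \<in> polygon_triangles N"
      using triangulation_card3[OF T t(1)] unfolding polygon_triangles_def by simp
  qed
  moreover have "\<not> crossing e f"
    if asms: "t \<in> T" "t' \<in> T" "e \<in> sides (\<sigma> ` t)" "f \<in> sides (\<sigma> ` t')" for t t' e f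
  proof -
    have pull: "\<exists>e'. e' \<in> sides t \<and> e = \<sigma> ` e'" if te: "t \<in> T" "e \<in> sides (\<sigma> ` t)" for t e
    proof -
      obtain e' where e': "e' \<subseteq> t" "e = \<sigma> ` e'"
        using te(2) unfolding sides_def by (auto simp: subset_image_iff)
      then have "card e = card e'"
        using triangulation_subset[OF T te(1)] inj by (metis card_image inj_on_subset)
      then show ?thesis using e' te(2) unfolding sides_def by auto
    qed
    obtain e' f' where *: "e' \<in> sides t" "e = \<sigma> ` e'" "f' \<in> sides t'" "f = \<sigma> ` f'"
      using pull[OF asms(1,3)] pull[OF asms(2,4)] by blast
    have "\<not> crossing e' f'" using T asms * unfolding triangulations_def by blast
    moreover have "e' \<subseteq> {..<N}" "f' \<subseteq> {..<N}"
      using * triangulation_subset[OF T] asms unfolding sides_def by blast+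
    ultimately show ?thesis using cr * by simp
  qed
  ultimately show ?thesis using T unfolding triangulations_def by auto
qed

lemma finite_triangulations: "finite (triangulations N)"
proof (rule finite_subset)
  show "triangulations N \<subseteq> Pow (Pow {..<N})"
    unfolding triangulations_def polygon_triangles_def by blast
qed simp

text \<open>
  An injective map of the finite set of symmetric triangulations into itself is a bijection; the
  commutation with the half turn guarantees that symmetry is kept.
\<close>

lemma bij_betw_move_symmetric:
  assumes \<sigma>: "polygon_symmetry (2*n+2) \<sigma>"
    and com: "\<And>x. x < 2*n+2 \<Longrightarrow> \<sigma> (half_turn n x) = half_turn n (\<sigma> x)"
  shows "bij_betw (move \<sigma>) (symmetric_triangulations n) (symmetric_triangulations n)"
proof -
  let ?S = "symmetric_triangulations n"
  have fin: "finite ?S"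
    using finite_triangulations unfolding symmetric_triangulations_def by simp
  have sub: "?S \<subseteq> Pow (Pow {..<2*n+2})"
    unfolding symmetric_triangulations_def triangulations_def polygon_triangles_def by blast
  have "move \<sigma> T \<in> ?S" if T: "T \<in> ?S" for T
  proof -
    have tr: "T \<in> triangulations (2*n+2)" and sym: "move (half_turn n) T = T"
      using T unfolding symmetric_triangulations_def by auto
    have "half_turn n ` \<sigma> ` t = \<sigma> ` half_turn n ` t" if "t \<in> T" for t
      using triangulation_subset[OF tr that] com by (force simp: image_image)
    then have "move (half_turn n) (move \<sigma> T) = move \<sigma> (move (half_turn n) T)"
      by (simp add: image_image)
    then show ?thesis
      using sym move_triangulation[OF \<sigma> tr] unfolding symmetric_triangulations_def by simp
  qed
  then have "move \<sigma> ` ?S \<subseteq> ?S" by blast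
  moreover have "inj_on (move \<sigma>) ?S" using inj_on_move[OF \<sigma>] sub by (rule inj_on_subset)
  ultimately show ?thesis using endo_inj_surj[OF fin] unfolding bij_betw_def by blast
qed

text \<open>The half turn is central in the dihedral group of the \<open>(2 * n + 2)\<close>-gon.\<close>

lemma half_turn_rotation: "rotation (2*n+2) r (half_turn n x) = half_turn n (rotation (2*n+2) r x)"
  unfolding rotation_def half_turn_def mod_add_left_eq by (simp add: ac_simps)

lemma half_turn_reflection:
  assumes "x < 2*n+2" "s < 2*n+2"
  shows "reflection (2*n+2) s (half_turn n x) = half_turn n (reflection (2*n+2) s x)"
proof -
  have h: "half_turn n y = (if y < n + 1 then y + (n + 1) else y - (n + 1))" if "y < 2*n+2" for y
    using that unfolding half_turn_def by (auto simp: mod_if)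
  show ?thesis using assms by (auto simp: h reflection_eq)
qed


section \<open>The fan of triangles at a vertex\<close>

text \<open>
  The triangles at \<open>0\<close> are lined up along the polygon without gaps; \<open>{0, b, c}\<close> is the one whose
  angle at \<open>0\<close> contains the midpoint of the edge from \<open>s\<close> to \<open>s + 1\<close>.
\<close>

definition fan_triangle :: "nat \<Rightarrow> nat set set \<Rightarrow> nat \<Rightarrow> nat \<Rightarrow> nat \<Rightarrow> bool" where
  "fan_triangle N T s b c \<longleftrightarrow> 0 < b \<and> b \<le> s \<and> s < c \<and> c < N \<and> {0, b, c} \<in> T"

definition fan_product :: "nat \<Rightarrow> nat set set \<Rightarrow> nat \<Rightarrow> nat" where
  "fan_product N T s = (THE w. \<exists>b c. fan_triangle N T s b c \<and> w = b * (N - c))"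

lemma fan_triangle_unique:
  assumes "T \<in> triangulations N" "fan_triangle N T s b c" "fan_triangle N T s b' c'"
  shows "b = b' \<and> c = c'"
proof -
  have F: False if "{0, b, c} \<in> T" "{0, b', c'} \<in> T" "0 < b" "b < b'" "b' < c" for b c b' c'
    by (rule triangulation_noncrossing[OF assms(1) that(2,1), of 0 b' b c]) (use that in auto)
  have G: False if "{0, b, c} \<in> T" "{0, b, c'} \<in> T" "0 < b" "b < c" "c < c'" for b c c'
    by (rule triangulation_noncrossing[OF assms(1) that(1,2), of 0 c b c']) (use that in auto)
  have "b = b'"
    using F[of b c b' c'] F[of b' c' b c] assms(2,3) unfolding fan_triangle_def
    by (cases b b' rule: linorder_cases) auto
  then show ?thesis
    using G[of b c c'] G[of b c' c] assms(2,3) unfolding fan_triangle_def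
    by (cases c c' rule: linorder_cases) auto
qed

lemma fan_product_eq:
  assumes "T \<in> triangulations N" "fan_triangle N T s b c"
  shows "fan_product N T s = b * (N - c)"
  unfolding fan_product_def using assms fan_triangle_unique by (intro the_equality) blast+

text \<open>
  A triangle of \<open>T\<close> is determined by its middle vertex, because distinct triangles with a common middle
  vertex have crossing sides. As \<open>T\<close> has \<open>N - 2\<close> triangles, every one of the \<open>N - 2\<close> candidates
  \<open>1, \<dots>, N - 2\<close> is a middle vertex. This counting is what makes \<open>T\<close> cover the whole polygon.
\<close>

lemma exists_triangle_with_middle:
  assumes T: "T \<in> triangulations N" and j: "0 < j" "j < N - 1"
  shows "\<exists>i k. i < j \<and> j < k \<and> k < N \<and> {i, j, k} \<in> T"
proof -
  define middle where "middle t = (THE j. \<exists>i k. i < j \<and> j < k \<and> t = {i, j, k})" for t :: "nat set"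
  have middle: "middle {i, j, k} = j" if "i < j" "j < k" for i j k
    unfolding middle_def
  proof (rule the_equality)
    show "\<exists>i' k'. i' < j \<and> j < k' \<and> {i, j, k} = {i', j, k'}" using that by blast
    fix j' assume "\<exists>i' k'. i' < j' \<and> j' < k' \<and> {i, j, k} = {i', j', k'}"
    then obtain i' k' where *: "i' < j'" "j' < k'" and eq: "{i, j, k} = {i', j', k'}" by blast
    have "i' \<in> {i, j, k}" "j' \<in> {i, j, k}" "k' \<in> {i, j, k}" unfolding eq by blast+
    moreover have "j \<in> {i', j', k'}" unfolding eq[symmetric] by blast
    ultimately show "j' = j" using that * by auto
  qed
  have shape: "\<exists>i j k. i < j \<and> j < k \<and> k < N \<and> t = {i, j, k}" if t: "t \<in> T" for t
  proof -
    obtain x y z where xyz: "t = {x, y, z}" "x \<noteq> y" "y \<noteq> z" "x \<noteq> z"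
      using triangulation_card3[OF T t] by (auto simp: card_3_iff)
    have lt: "x < N" "y < N" "z < N" using triangulation_subset[OF T t] xyz by auto
    have perms: "t = {x, z, y}" "t = {y, x, z}" "t = {y, z, x}" "t = {z, x, y}" "t = {z, y, x}"
      using xyz(1) by auto
    have sorted: "\<exists>i j k. i < j \<and> j < k \<and> k < N \<and> t = {i, j, k}"
      if "i < j" "j < k" "k < N" "t = {i, j, k}" for i j k
      by (intro exI[of _ i] exI[of _ j] exI[of _ k]) (use that in simp)
    consider "x < y" "y < z" | "x < z" "z < y" | "y < x" "x < z" | "y < z" "z < x"
      | "z < x" "x < y" | "z < y" "y < x" using xyz by linarith
    then show ?thesis
    proof cases
      case 1 show ?thesis by (rule sorted[OF 1 lt(3) xyz(1)])
    next
      case 2 show ?thesis by (rule sorted[OF 2 lt(2) perms(1)])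
    next
      case 3 show ?thesis by (rule sorted[OF 3 lt(3) perms(2)])
    next
      case 4 show ?thesis by (rule sorted[OF 4 lt(1) perms(3)])
    next
      case 5 show ?thesis by (rule sorted[OF 5 lt(2) perms(4)])
    next
      case 6 show ?thesis by (rule sorted[OF 6 lt(1) perms(5)])
    qed
  qed
  have "inj_on middle T"
  proof (rule inj_onI)
    fix t t' assume t: "t \<in> T" "t' \<in> T" "middle t = middle t'"
    obtain i j k where a: "i < j" "j < k" "t = {i, j, k}" using shape[OF t(1)] by blast
    obtain i' j' k' where b: "i' < j'" "j' < k'" "t' = {i', j', k'}" using shape[OF t(2)] by blast
    have jj: "j' = j" using t(3) middle[OF a(1,2)] middle[OF b(1,2)] a(3) b(3) by simp
    have F: False if "{i, j, k} \<in> T" "{i', j, k'} \<in> T" "i < i'" "i' < j" "j < k'" for i k i' k'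
      by (rule triangulation_noncrossing[OF T that(1,2), of i j i' k']) (use that in auto)
    have G: False if "{i, j, k} \<in> T" "{i, j, k'} \<in> T" "i < j" "j < k" "k < k'" for i k k'
      by (rule triangulation_noncrossing[OF T that(1,2), of i k j k']) (use that in auto)
    have "i = i'" using F[of i k i' k'] F[of i' k' i k] a b t(1,2) jj
      by (cases i i' rule: linorder_cases) auto
    moreover have "k = k'" using G[of i k k'] G[of i k' k] a b t(1,2) jj calculation
      by (cases k k' rule: linorder_cases) auto
    ultimately show "t = t'" using a b jj by simp
  qed
  then have "card (middle ` T) = N - 2"
    using T card_image unfolding triangulations_def by fastforce
  moreover have "middle ` T \<subseteq> {0<..<N-1}"
  proof
    fix m assume "m \<in> middle ` T"
    then obtain t where t: "t \<in> T" "m = middle t" by blast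
    obtain i j k where *: "i < j" "j < k" "k < N" "t = {i, j, k}" using shape[OF t(1)] by blast
    then show "m \<in> {0<..<N-1}" using middle[OF *(1,2)] t(2) by auto
  qed
  ultimately have "middle ` T = {0<..<N-1}" by (intro card_subset_eq) auto
  then have "j \<in> middle ` T" using j by simp
  then obtain t where t: "t \<in> T" "middle t = j" by blast
  obtain i m k where *: "i < m" "m < k" "k < N" "t = {i, m, k}" using shape[OF t(1)] by blast
  have "m = j" using middle[OF *(1,2)] t(2) *(4) by simp
  then show ?thesis using * t(1) by blast
qed

text \<open>
  The rotation by \<open>N - 1 - s\<close> takes \<open>s\<close> and \<open>s + 1\<close> to the two ends \<open>N - 1\<close> and \<open>0\<close> of the numbering;
  then separating them at \<open>0\<close> means having the image of \<open>0\<close> as middle vertex.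
\<close>

lemma fan_triangle_exists:
  assumes T: "T \<in> triangulations N" and s: "0 < s" "s < N - 1"
  shows "\<exists>b c. fan_triangle N T s b c"
proof -
  define j where "j = N - 1 - s"
  have j: "0 < j" "j < N - 1" "N - j = s + 1" "j \<le> N" using s unfolding j_def by auto
  have "move (rotation N j) T \<in> triangulations N"
    using move_triangulation[OF polygon_symmetry_rotation T] j by simp
  from exists_triangle_with_middle[OF this j(1,2)]
  obtain i k where ik: "i < j" "j < k" "k < N" "{i, j, k} \<in> move (rotation N j) T" by blast
  then obtain t where t: "t \<in> T" "{i, j, k} = rotation N j ` t" by blast
  have "rotation N (s + 1) (rotation N j x) = x" if "x \<in> t" for x
  proof -
    have "x < N" using triangulation_subset[OF T t(1)] that by blast
    then show ?thesis using rotation_inverse[of x N j] j(3,4) by simp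
  qed
  then have "rotation N (s + 1) ` {i, j, k} = t"
    unfolding t(2) image_image by (rule image_cong[OF refl, of _ _ "\<lambda>x. x", simplified image_ident])
  moreover have "rotation N (s + 1) ` {i, j, k} = {0, k - j, i + s + 1}"
  proof -
    have "rotation N (s + 1) i = i + s + 1" "rotation N (s + 1) j = 0"
      "rotation N (s + 1) k = k - j"
      using ik(1-3) s unfolding j_def by (auto simp: rotation_eq)
    then show ?thesis by (simp add: insert_commute)
  qed
  ultimately have "{0, k - j, i + s + 1} \<in> T" using t(1) by metis
  then have "fan_triangle N T s (k - j) (i + s + 1)"
    using ik j unfolding fan_triangle_def by auto
  then show ?thesis by blast
qed


section \<open>Averaging over the centrally symmetric triangulations\<close>

lemma reflect_fan_edge:
  assumes "T \<in> triangulations N" "0 < s" "s < N" "x < N" "{0, s, x} \<in> T"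
  shows "{0, s, reflection N s x} \<in> move (reflection N s) T"
proof -
  have "reflection N s ` {0, s, x} = {0, s, reflection N s x}"
    using assms by (auto simp: reflection_eq)
  then show ?thesis using imageI[OF assms(5), of "(`) (reflection N s)"] by simp
qed

lemma reflect_twice:
  assumes "T \<in> triangulations N" "s < N"
  shows "move (reflection N s) (move (reflection N s) T) = T"
proof -
  have "reflection N s ` reflection N s ` t = t" if "t \<in> T" for t
  proof -
    have "reflection N s (reflection N s x) = x" if "x \<in> t" for x
    proof -
      have "x < N" using triangulation_subset[OF assms(1) \<open>t \<in> T\<close>] that by blast
      then show ?thesis using assms(2) by (auto simp: reflection_eq)
    qed
    then show ?thesis by (simp add: image_image)
  qed
  then show ?thesis by (simp add: image_image)
qed

text \<open>
  Passing from \<open>s - 1\<close> to \<open>s\<close> changes the triangle at \<open>0\<close> only if the chord from \<open>0\<close> to \<open>s\<close> occurs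
  in the triangulation; then the two triangles involved are those on either side of this chord.
  The reflection exchanging \<open>0\<close> and \<open>s\<close> preserves both sides of the chord, replacing the apices
  \<open>b\<close> and \<open>c\<close> by \<open>s - b\<close> and \<open>N + s - c\<close>, and this negates \<open>b * (N - s) - s * (N - c)\<close>.
\<close>

lemma fan_product_step_reflect:
  fixes N s :: nat
  assumes T: "T \<in> triangulations N" and s: "2 \<le> s" "s \<le> N - 2"
  defines "D \<equiv> \<lambda>T. real (fan_product N T (s - 1)) - real (fan_product N T s)"
  shows "D (move (reflection N s) T) = - D T"
proof -
  let ?R = "move (reflection N s)"
  have sN: "s < N" "s < N - 1" "0 < s" "0 < s - 1" "s - 1 < N - 1" using s by auto
  have T': "?R T \<in> triangulations N"
    using move_triangulation[OF polygon_symmetry_reflection[OF sN(1)] T] .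
  show ?thesis
  proof (cases "\<exists>b. fan_triangle N T (s - 1) b s")
    case True
    then obtain b where b: "fan_triangle N T (s - 1) b s" by blast
    obtain b' c where c': "fan_triangle N T s b' c"
      using fan_triangle_exists[OF T] sN by blast
    have "b' = s"
    proof (rule ccontr)
      assume "b' \<noteq> s"
      then have "fan_triangle N T (s - 1) b' c" using c' unfolding fan_triangle_def by auto
      then have "c = s" using fan_triangle_unique[OF T b] by blast
      then show False using c' unfolding fan_triangle_def by simp
    qed
    with c' have c: "fan_triangle N T s s c" by simp
    have B: "0 < b" "b < s" and C: "s < c" "c < N"
      using b c sN unfolding fan_triangle_def by auto
    have "{0, s, reflection N s b} \<in> ?R T" "{0, s, reflection N s c} \<in> ?R T"
      using b c B C sN unfolding fan_triangle_def
      by (intro reflect_fan_edge[OF T]; simp add: insert_commute)+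
    then have b2: "fan_triangle N (?R T) (s - 1) (s - b) s"
      and c2: "fan_triangle N (?R T) s s (N + s - c)"
      using B C sN unfolding fan_triangle_def by (auto simp: reflection_eq insert_commute)
    have diffs: "N - (N + s - c) = c - s" "real (s - b) = real s - real b"
      "real (N - s) = real N - real s" "real (c - s) = real c - real s"
      "real (N - c) = real N - real c"
      using B C by auto
    show ?thesis
      unfolding D_def fan_product_eq[OF T b] fan_product_eq[OF T c]
        fan_product_eq[OF T' b2] fan_product_eq[OF T' c2] of_nat_mult diffs
      by (simp add: algebra_simps)
  next
    case False
    have zero: "D U = 0" if U: "U \<in> triangulations N"
      and no: "\<nexists>b. fan_triangle N U (s - 1) b s" for U
    proof -
      obtain b c where bc: "fan_triangle N U (s - 1) b c"
        using fan_triangle_exists[OF U] sN by blast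
      then have "c \<noteq> s" using no by blast
      then have "fan_triangle N U s b c" using bc unfolding fan_triangle_def by auto
      then show ?thesis unfolding D_def using fan_product_eq[OF U bc] fan_product_eq[OF U] by simp
    qed
    have "\<nexists>b. fan_triangle N (?R T) (s - 1) b s"
    proof
      assume "\<exists>b. fan_triangle N (?R T) (s - 1) b s"
      then obtain b where b: "fan_triangle N (?R T) (s - 1) b s" by blast
      then have B: "0 < b" "b < s" using sN unfolding fan_triangle_def by auto
      have "{0, s, reflection N s b} \<in> ?R (?R T)"
        using b B sN unfolding fan_triangle_def
        by (intro reflect_fan_edge[OF T']) (simp_all add: insert_commute)
      then have "{0, s - b, s} \<in> T"
        unfolding reflect_twice[OF T sN(1)] using B sN by (simp add: reflection_eq insert_commute)
      then have "fan_triangle N T (s - 1) (s - b) s"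
        using B sN unfolding fan_triangle_def by auto
      then show False using False by blast
    qed
    then show ?thesis using zero[OF T] zero[OF T'] False by simp
  qed
qed

text \<open>
  For \<open>s = 1\<close> the triangle is the one on the edge from \<open>0\<close> to \<open>1\<close>, and the reflection exchanging
  the endpoints of this edge replaces its weight \<open>N - c\<close> by \<open>c - 1\<close>.
\<close>

lemma fan_product_first_reflect:
  assumes T: "T \<in> triangulations N" and N: "3 \<le> N"
  shows "fan_product N T 1 + fan_product N (move (reflection N 1) T) 1 = N - 1"
proof -
  let ?R = "move (reflection N 1)"
  have T': "?R T \<in> triangulations N"
    using move_triangulation[OF polygon_symmetry_reflection T] N by simp
  have "0 < (1::nat)" "1 < N - 1" using N by auto
  from fan_triangle_exists[OF T this]
  obtain b c where bc: "fan_triangle N T 1 b c" by blast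
  then have "b = 1" unfolding fan_triangle_def by auto
  with bc have c: "fan_triangle N T 1 1 c" by simp
  have C: "1 < c" "c < N" using c unfolding fan_triangle_def by auto
  have "{0, 1, reflection N 1 c} \<in> ?R T"
    by (rule reflect_fan_edge[OF T]) (use c N in \<open>simp_all add: fan_triangle_def\<close>)
  moreover have "reflection N 1 c = N + 1 - c" using C by (simp add: reflection_eq)
  moreover have "1 < N + 1 - c" "N + 1 - c < N" using C by linarith+
  ultimately have c2: "fan_triangle N (?R T) 1 1 (N + 1 - c)"
    unfolding fan_triangle_def by simp
  show ?thesis unfolding fan_product_eq[OF T c] fan_product_eq[OF T' c2] using C by simp
qed

lemma symmetric_triangulation:
  "T \<in> symmetric_triangulations n \<Longrightarrow> T \<in> triangulations (2*n+2)"
  unfolding symmetric_triangulations_def by simp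

text \<open>
  By the two reflections above, the sum does not depend on \<open>s\<close>, and for \<open>s = 1\<close> the terms average
  to \<open>(N - 1) / 2\<close> with \<open>N = 2 * n + 2\<close>.
\<close>

lemma sum_fan_product:
  assumes "1 \<le> s" "s \<le> 2*n"
  shows "(\<Sum>T\<in>symmetric_triangulations n. real (fan_product (2*n+2) T s))
    = (2 * real n + 1) / 2 * real (card (symmetric_triangulations n))"
  using assms
proof (induction s rule: dec_induct)
  case base
  let ?S = "symmetric_triangulations n" and ?R = "move (reflection (2*n+2) 1)"
  let ?f = "\<lambda>T. real (fan_product (2*n+2) T 1)"
  have bij: "bij_betw ?R ?S ?S"
    by (intro bij_betw_move_symmetric polygon_symmetry_reflection half_turn_reflection) auto
  have pair: "?f T + ?f (?R T) = 2 * real n + 1" if T: "T \<in> ?S" for T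
  proof -
    have "fan_product (2*n+2) T 1 + fan_product (2*n+2) (?R T) 1 = 2*n+2 - 1"
      by (rule fan_product_first_reflect[OF symmetric_triangulation[OF T]]) (use base in simp)
    then show ?thesis unfolding of_nat_add[symmetric] by simp
  qed
  have "(\<Sum>T\<in>?S. ?f T) + (\<Sum>T\<in>?S. ?f T) = (\<Sum>T\<in>?S. ?f T) + (\<Sum>T\<in>?S. ?f (?R T))"
    using sum.reindex_bij_betw[OF bij, of ?f] by simp
  also have "\<dots> = (\<Sum>T\<in>?S. 2 * real n + 1)"
    unfolding sum.distrib[symmetric] by (rule sum.cong) (use pair in auto)
  finally show ?case by (simp add: mult.commute)
next
  case (step s)
  let ?S = "symmetric_triangulations n" and ?R = "move (reflection (2*n+2) (Suc s))"
  let ?D = "\<lambda>T. real (fan_product (2*n+2) T s) - real (fan_product (2*n+2) T (Suc s))"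
  have bij: "bij_betw ?R ?S ?S"
    by (intro bij_betw_move_symmetric polygon_symmetry_reflection half_turn_reflection)
      (use step.prems in auto)
  have neg: "?D (?R T) = - ?D T" if T: "T \<in> ?S" for T
    using fan_product_step_reflect[OF symmetric_triangulation[OF T], of "Suc s"] step by simp
  have "(\<Sum>T\<in>?S. ?D T) = (\<Sum>T\<in>?S. ?D (?R T))"
    using sum.reindex_bij_betw[OF bij, of ?D] by simp
  also have "\<dots> = - (\<Sum>T\<in>?S. ?D T)"
    unfolding sum_negf[symmetric] by (rule sum.cong) (use neg in auto)
  finally have "(\<Sum>T\<in>?S. ?D T) = 0" by simp
  then show ?case using step by (simp add: sum_subtractf)
qed

text \<open>
  Needed so that the isobarycenter is unique. The witness consists of the diameter from \<open>0\<close> to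
  \<open>n + 1\<close>, the fan at \<open>0\<close> on one side of it and the fan at \<open>n + 1\<close> on the other.
\<close>

lemma symmetric_triangulations_nonempty:
  assumes n: "n \<ge> 1" shows "symmetric_triangulations n \<noteq> {}"
proof -
  define N where "N = 2*n+2"
  define A where "A = (\<lambda>i. {0, i, i + 1 :: nat}) ` {1..n}"
  define B where "B = (\<lambda>t. half_turn n ` t) ` A"
  have h1: "half_turn n x = x + n + 1" if "x < n + 1" for x
    using that unfolding half_turn_def by simp
  have h2: "half_turn n x = x - n - 1" if "n + 1 \<le> x" "x < N" for x
    using that unfolding half_turn_def N_def by (auto simp: mod_if)
  have hh: "half_turn n (half_turn n x) = x" if "x < N" for x
    using that h1 h2 by (cases "x < n + 1") (auto simp: N_def)
  have Asub: "t \<subseteq> {..<n+2}" if "t \<in> A" for t using that unfolding A_def by auto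
  have ANsub: "t \<subseteq> {..<N}" if "t \<in> A" for t using Asub[OF that] unfolding N_def by auto
  have inj: "inj_on (half_turn n) {..<N}" 
    by (rule inj_on_inverseI[where g = "half_turn n"]) (use hh in auto)
  have hlt: "half_turn n x < N" for x unfolding half_turn_def N_def by simp
  have "inj_on (\<lambda>i. {0, i, i + 1 :: nat}) {1..n}"
  proof (rule inj_onI)
    fix i j assume ij: "i \<in> {1..n}" "j \<in> {1..n}" and eq: "{0, i, i + 1} = {0, j, j + 1}"
    have "i \<in> {0, j, j + 1}" unfolding eq[symmetric] by simp
    moreover have "j \<in> {0, i, i + 1}" unfolding eq by simp
    ultimately show "i = j" using ij by auto
  qed
  then have cA: "card A = n" unfolding A_def by (simp add: card_image)
  have "inj_on (\<lambda>t. half_turn n ` t) A"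
    using inj_on_subset[OF inj_on_image_Pow[OF inj], of A] ANsub by blast
  then have cB: "card B = n" unfolding B_def using cA by (simp add: card_image)
  have disj: "A \<inter> B = {}"
  proof (rule ccontr)
    assume "A \<inter> B \<noteq> {}"
    then obtain t where t: "t \<in> A" "t \<in> B" by blast
    then obtain i where i: "1 \<le> i" "i \<le> n" "t = half_turn n ` {0, i, i + 1}"
      unfolding B_def A_def by auto
    have "half_turn n i \<in> t" using i by blast
    then show False using h1[of i] i Asub[OF t(1)] by auto
  qed
  have three: "card t = 3" if "t \<in> A" for t
    using that unfolding A_def by (auto simp: card_insert_if)
  have poly: "A \<union> B \<subseteq> polygon_triangles N"
  proof -
    have "card (half_turn n ` t) = 3" if "t \<in> A" for t
      using card_image[OF inj_on_subset[OF inj ANsub[OF that]]] three[OF that] by simp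
    then show ?thesis using three ANsub hlt unfolding polygon_triangles_def B_def by blast
  qed
  have finite: "finite A" "finite B" unfolding B_def A_def by auto
  have card: "card (A \<union> B) = N - 2"
    using card_Un_disjoint[OF finite disj] cA cB unfolding N_def by simp
  \<comment> \<open>Two of these chords with alternating endpoints would both have length at least two, hence
    start at \<open>0\<close> or at \<open>n + 1\<close>; no chord from \<open>0\<close> runs beyond \<open>n + 1\<close> except the last edge.\<close>
  have chord: "y = x + 1 \<or> x = 0 \<and> (y \<le> n + 1 \<or> y = N - 1) \<or> x = n + 1"
    if t: "t \<in> A \<union> B" and xy: "{x, y} \<subseteq> t" "x < y" for t x y
  proof (cases "t \<in> A")
    case True
    then show ?thesis using xy unfolding A_def by auto
  next
    case False
    then obtain i where i: "1 \<le> i" "i \<le> n" "t = half_turn n ` {0, i, i + 1}"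
      using t unfolding B_def A_def by auto
    have "half_turn n 0 = n + 1" "half_turn n i = i + n + 1"
      "half_turn n (i + 1) = (if i = n then 0 else i + n + 2)"
      using i h1[of 0] h1[of i] h1[of "i + 1"] h2[of "i + 1"] n unfolding N_def by auto
    then have "t = {n + 1, i + n + 1, if i = n then 0 else i + n + 2}" using i(3) by simp
    then show ?thesis using xy i(1,2) unfolding N_def by (auto split: if_splits)
  qed
  have cross: False if "t \<in> A \<union> B" "t' \<in> A \<union> B" "{a, c} \<subseteq> t" "{b, d} \<subseteq> t'"
    "a < b" "b < c" "c < d" for t t' a b c d
  proof -
    have "d < N" using that poly unfolding polygon_triangles_def by auto
    then show False using chord[OF that(1,3)] chord[OF that(2,4)] that(5-7) by auto
  qed
  have "\<not> crossing e f" if "t \<in> A \<union> B" "t' \<in> A \<union> B" "e \<in> sides t" "f \<in> sides t'" for t t' e f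
  proof
    assume "crossing e f"
    then obtain a b c d where lt: "a < b" "b < c" "c < d"
      and ef: "e = {a, c} \<and> f = {b, d} \<or> e = {b, d} \<and> f = {a, c}"
      unfolding crossing_def by blast
    have "e \<subseteq> t" "f \<subseteq> t'" using that unfolding sides_def by auto
    then show False
      using ef cross[OF that(1,2) _ _ lt] cross[OF that(2,1) _ _ lt] by auto
  qed
  then have "A \<union> B \<in> triangulations N" using poly card unfolding triangulations_def by blast
  moreover have "move (half_turn n) (A \<union> B) = A \<union> B"
  proof -
    have "half_turn n ` half_turn n ` t = t" if "t \<in> A" for t
      using ANsub[OF that] hh by (force simp: image_image)
    then have "move (half_turn n) B = A" unfolding B_def by (simp add: image_image)
    moreover have "move (half_turn n) A = B" unfolding B_def ..
    ultimately show ?thesis unfolding image_Un by blast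
  qed
  ultimately show ?thesis unfolding symmetric_triangulations_def N_def by blast
qed

section \<open>Labels and weights as seen from a vertex\<close>

text \<open>The vertices are numbered here by the number of counterclockwise steps from \<open>p\<close>.\<close>

definition label_from :: "nat \<Rightarrow> (nat \<times> nat) set \<Rightarrow> nat \<Rightarrow> nat \<Rightarrow> nat" where
  "label_from n E p i = vertex_label n E ((p + i) mod (2*n+2))"

abbreviation labelling :: "nat \<Rightarrow> (nat \<times> nat) set \<Rightarrow> bool" where
  "labelling n E \<equiv> bij_betw (vertex_label n E) {..<2*n+2} {..<2*n+2}"

lemma vertex_at_label:
  assumes "labelling n E" "q < 2*n+2"
  shows "vertex_at n E (vertex_label n E q) = q"
  unfolding vertex_at_def
  by (rule the_equality) (use assms in \<open>auto simp: bij_betw_def inj_on_def\<close>)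

lemma ccw_distance:
  fixes N :: nat
  assumes "p < N" "0 < j" "j < N"
  shows "((p + j) mod N + N - p) mod N = j" "(p + N - (p + j) mod N) mod N = N - j"
  using assms by (auto simp: mod_if)

lemma bij_betw_label_from:
  assumes "labelling n E" "p < 2*n+2"
  shows "bij_betw (label_from n E p) {..<2*n+2} {..<2*n+2}"
proof -
  have "bij_betw (rotation (2*n+2) p) {..<2*n+2} {..<2*n+2}"
    using polygon_symmetry_rotation[of p "2*n+2"] assms(2) unfolding polygon_symmetry_def by simp
  then have "bij_betw (vertex_label n E \<circ> rotation (2*n+2) p) {..<2*n+2} {..<2*n+2}"
    using assms(1) by (rule bij_betw_trans)
  moreover have "vertex_label n E \<circ> rotation (2*n+2) p = label_from n E p"
    by (rule ext) (simp add: label_from_def rotation_def add.commute)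
  ultimately show ?thesis by simp
qed

lemma label_from_0: "p < 2*n+2 \<Longrightarrow> label_from n E p 0 = vertex_label n E p"
  unfolding label_from_def by simp

lemma label_from_eq_iff:
  assumes "labelling n E" "p < 2*n+2" "i < 2*n+2" "j < 2*n+2"
  shows "label_from n E p i = label_from n E p j \<longleftrightarrow> i = j"
  using bij_betw_label_from[OF assms(1,2)] assms(3,4) unfolding bij_betw_def inj_on_def by auto

lemma set_ccw_path: "set (ccw_path N p q) = (\<lambda>s. (p + s) mod N) ` {0..<Suc ((q + N - p) mod N)}"
  unfolding ccw_path_def set_map set_upt ..

lemma label_ccw_path:
  assumes "p < 2*n+2" "0 < j" "j < 2*n+2"
  shows "vertex_label n E ` set (ccw_path (2*n+2) p ((p + j) mod (2*n+2)))
      = label_from n E p ` {0..j}"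
    and "vertex_label n E ` set (ccw_path (2*n+2) ((p + j) mod (2*n+2)) p)
      = label_from n E p ` {j..2*n+2}"
proof -
  show "vertex_label n E ` set (ccw_path (2*n+2) p ((p + j) mod (2*n+2)))
      = label_from n E p ` {0..j}"
    unfolding set_ccw_path ccw_distance[OF assms] image_image label_from_def
      atLeastLessThanSuc_atLeastAtMost ..
  have "label_from n E p ` {j..2*n+2} = label_from n E p ` ((+) j ` {0..2*n+2-j})"
    unfolding image_add_atLeastAtMost using assms by simp
  also have "\<dots> = (\<lambda>s. vertex_label n E (((p + j) mod (2*n+2) + s) mod (2*n+2))) ` {0..2*n+2-j}"
    unfolding image_image label_from_def mod_add_left_eq by (simp add: add.assoc)
  finally show "vertex_label n E ` set (ccw_path (2*n+2) ((p + j) mod (2*n+2)) p)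
      = label_from n E p ` {j..2*n+2}"
    unfolding set_ccw_path ccw_distance[OF assms] image_image atLeastLessThanSuc_atLeastAtMost by simp
qed

lemma length_ccw_path: "length (ccw_path N p q) = Suc ((q + N - p) mod N)"
  unfolding ccw_path_def by simp

text \<open>
  A label outside \<open>L\<close> on one of the two boundary paths makes the other one the path selected by
  the definite description.
\<close>

lemma path_edges_ccw:
  assumes lab: "labelling n E" and p: "p < 2*n+2" and j: "0 < j" "j < 2*n+2"
    and inside: "\<And>i. i \<le> j \<Longrightarrow> label_from n E p i \<in> L"
    and outside: "j \<le> i" "i < 2*n+2" "label_from n E p i \<notin> L"
  shows "path_edges n E L (vertex_label n E p) (label_from n E p j) = j"
proof -
  let ?q = "(p + j) mod (2*n+2)"
  have q: "?q < 2*n+2" by simp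
  have "label_from n E p ` {0..j} \<subseteq> L" using inside by auto
  moreover have "\<not> label_from n E p ` {j..2*n+2} \<subseteq> L" using outside by (force simp: image_subset_iff)
  ultimately have path: "(THE \<pi>. \<pi> \<in> boundary_paths (2*n+2) p ?q \<and> vertex_label n E ` set \<pi> \<subseteq> L)
      = ccw_path (2*n+2) p ?q"
    unfolding boundary_paths_def using label_ccw_path[OF p j]
    by (intro the_equality) auto
  show ?thesis
    unfolding path_edges_def vertex_at_label[OF lab p]
      vertex_at_label[OF lab q, folded label_from_def] path length_rev length_ccw_path ccw_distance[OF p j]
    by simp
qed

lemma path_edges_cw:
  assumes lab: "labelling n E" and p: "p < 2*n+2" and j: "0 < j" "j < 2*n+2"
    and inside: "\<And>i. j \<le> i \<Longrightarrow> i \<le> 2*n+2 \<Longrightarrow> label_from n E p i \<in> L"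
    and outside: "i \<le> j" "label_from n E p i \<notin> L"
  shows "path_edges n E L (vertex_label n E p) (label_from n E p j) = 2*n+2 - j"
proof -
  let ?q = "(p + j) mod (2*n+2)"
  have q: "?q < 2*n+2" by simp
  have "label_from n E p ` {j..2*n+2} \<subseteq> L" using inside by auto
  moreover have "\<not> label_from n E p ` {0..j} \<subseteq> L" using outside by (force simp: image_subset_iff)
  ultimately have path: "(THE \<pi>. \<pi> \<in> boundary_paths (2*n+2) p ?q \<and> vertex_label n E ` set \<pi> \<subseteq> L)
      = rev (ccw_path (2*n+2) ?q p)"
    unfolding boundary_paths_def using label_ccw_path[OF p j]
    by (intro the_equality) auto
  show ?thesis
    unfolding path_edges_def vertex_at_label[OF lab p]
      vertex_at_label[OF lab q, folded label_from_def] path length_rev length_ccw_path ccw_distance[OF p j]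
    by simp
qed

lemma triangle_at_label:
  assumes T: "T \<in> triangulations (2*n+2)" and lab: "labelling n E" and p: "p < 2*n+2"
    and ij: "i < 2*n+2" "j < 2*n+2"
  shows "(\<exists>t\<in>T. vertex_label n E ` t = {label_from n E p i, vertex_label n E p, label_from n E p j})
    \<longleftrightarrow> {0, i, j} \<in> move (rotation (2*n+2) (2*n+2 - p)) T"
proof -
  let ?N = "2*n+2"
  let ?r = "rotation ?N p" and ?r' = "rotation ?N (?N - p)"
  let ?u = "{0, i, j}"
  have u: "?u \<subseteq> {..<?N}" using ij by simp
  have im: "vertex_label n E ` ?r ` ?u = {label_from n E p i, vertex_label n E p, label_from n E p j}"
    using p by (simp add: rotation_def label_from_def add.commute insert_commute)
  have rr': "?r ` ?r' ` t = t" if "t \<subseteq> {..<?N}" for t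
    using rotation_inverse[of _ ?N "?N - p"] p that by (force simp: image_image)
  have r'r: "?r' ` ?r ` t = t" if "t \<subseteq> {..<?N}" for t
    using rotation_inverse[of _ ?N p] p that by (force simp: image_image)
  have "?r ` ?u \<subseteq> {..<?N}" unfolding rotation_def by auto
  then have eq: "vertex_label n E ` t = vertex_label n E ` ?r ` ?u \<longleftrightarrow> t = ?r ` ?u"
    if "t \<in> T" for t
    using inj_on_image_eq_iff[of "vertex_label n E" "{..<?N}" t "?r ` ?u"]
      triangulation_subset[OF T that] lab unfolding bij_betw_def by simp
  have "(\<exists>t\<in>T. vertex_label n E ` t = vertex_label n E ` ?r ` ?u) \<longleftrightarrow> ?r ` ?u \<in> T"
    using eq by blast
  also have "\<dots> \<longleftrightarrow> ?u \<in> move ?r' T"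
  proof
    assume "?r ` ?u \<in> T"
    then have "?r' ` ?r ` ?u \<in> move ?r' T" by (rule imageI)
    then show "?u \<in> move ?r' T" unfolding r'r[OF u] .
  next
    assume "?u \<in> move ?r' T"
    then obtain t where t: "t \<in> T" "?u = ?r' ` t" by (rule imageE)
    then show "?r ` ?u \<in> T" using rr'[OF triangulation_subset[OF T t(1)]] by simp
  qed
  finally show ?thesis unfolding im .
qed

lemma middle_triangle_eq:
  assumes T: "T \<in> triangulations (2*n+2)" and lab: "labelling n E" and p: "p < 2*n+2"
  defines "T' \<equiv> move (rotation (2*n+2) (2*n+2 - p)) T"
  assumes ij: "i < 2*n+2" "j < 2*n+2" "{0, i, j} \<in> T'"
    and order: "label_from n E p i < vertex_label n E p" "vertex_label n E p < label_from n E p j"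
    and unique: "\<And>i' j'. i' < 2*n+2 \<Longrightarrow> j' < 2*n+2 \<Longrightarrow> {0, i', j'} \<in> T' \<Longrightarrow>
      label_from n E p i' < vertex_label n E p \<Longrightarrow> vertex_label n E p < label_from n E p j' \<Longrightarrow>
      i' = i \<and> j' = j"
  shows "middle_triangle n E T (vertex_label n E p) = (label_from n E p i, label_from n E p j)"
  unfolding middle_triangle_def
proof (rule the_equality, goal_cases)
  case 1
  have "\<exists>t\<in>T. vertex_label n E ` t = {label_from n E p i, vertex_label n E p, label_from n E p j}"
    using ij(3) unfolding triangle_at_label[OF T lab p ij(1,2)] T'_def .
  then show ?case using order by simp
next
  case (2 km)
  let ?f = "label_from n E p" and ?l = "vertex_label n E p"
  obtain k m where km: "km = (k, m)" by (cases km)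
  with 2 have km': "k < ?l" "?l < m" and t: "\<exists>t\<in>T. vertex_label n E ` t = {k, ?l, m}" by auto
  have "{k, m} \<subseteq> {..<2*n+2}"
    using t triangulation_subset[OF T] bij_betw_imp_surj_on[OF lab] by blast
  then have "k \<in> ?f ` {..<2*n+2}" "m \<in> ?f ` {..<2*n+2}"
    using bij_betw_imp_surj_on[OF bij_betw_label_from[OF lab p]] by auto
  then obtain i' j' where ij': "k = ?f i'" "i' < 2*n+2" "m = ?f j'" "j' < 2*n+2" by auto
  have "{0, i', j'} \<in> T'"
    using t unfolding ij'(1,3) triangle_at_label[OF T lab p ij'(2,4)] T'_def .
  then show ?case using unique[OF ij'(2,4)] km km' ij' by simp
qed

text \<open>
  Rotate the vertex labeled \<open>l\<close> to \<open>0\<close> and suppose that the vertices with labels above \<open>l\<close> are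
  \<open>1, \<dots>, s\<close>. Then \<open>l\<close> is the middle label of a triangle at \<open>0\<close> exactly if the triangle separates
  \<open>s\<close> from \<open>s + 1\<close>, that is, if it is the fan triangle for \<open>s\<close>. The boundary paths in the
  definition of the weight cannot run through the wrong side, so they have lengths \<open>b\<close> and \<open>N - c\<close>.
\<close>

lemma weight_down:
  assumes T: "T \<in> triangulations (2*n+2)" and lab: "labelling n E" and p: "p < 2*n+2"
    and s: "0 < s" "s \<le> 2*n"
    and above: "\<And>j. 0 < j \<Longrightarrow> j < 2*n+2 \<Longrightarrow> vertex_label n E p < label_from n E p j \<longleftrightarrow> j \<le> s"
  shows "weight n E T (vertex_label n E p)
    = fan_product (2*n+2) (move (rotation (2*n+2) (2*n+2 - p)) T) s"
proof -
  let ?N = "2*n+2"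
  let ?T = "move (rotation ?N (?N - p)) T" and ?f = "label_from n E p" and ?l = "vertex_label n E p"
  have T': "?T \<in> triangulations ?N"
    by (rule move_triangulation[OF polygon_symmetry_rotation T]) simp
  have sN: "s < ?N - 1" using s by simp
  obtain b c where bc: "fan_triangle ?N ?T s b c" using fan_triangle_exists[OF T' s(1) sN] by blast
  have b: "0 < b" "b \<le> s" "b < ?N" and c: "s < c" "c < ?N" "0 < c"
    using bc unfolding fan_triangle_def by auto
  have below: "?f j < ?l \<longleftrightarrow> s < j" if "0 < j" "j < ?N" for j
  proof -
    have "?f j \<noteq> ?l" using label_from_eq_iff[OF lab p that(2), of 0] that p by (simp add: label_from_0)
    then show ?thesis using above[OF that] by auto
  qed
  have f0: "?f 0 = ?l" "?f ?N = ?l" using p unfolding label_from_def mod_add_self2 by simp_all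
  have "middle_triangle n E T ?l = (?f c, ?f b)"
  proof (rule middle_triangle_eq[OF T lab p c(2) b(3)])
    show "{0, c, b} \<in> ?T" using bc unfolding fan_triangle_def by (simp add: insert_commute)
    show "?f c < ?l" "?l < ?f b" using above[OF b(1,3)] below[OF c(3,2)] b c by simp_all
    show "i = c \<and> j = b" if "i < ?N" "j < ?N" "{0, i, j} \<in> ?T" "?f i < ?l" "?l < ?f j" for i j
    proof -
      have pos: "0 < i" "0 < j" using that f0 by (auto intro: gr0I)
      then have "fan_triangle ?N ?T s j i"
        using that below[OF pos(1)] above[OF pos(2)] unfolding fan_triangle_def
        by (simp add: insert_commute)
      then show ?thesis using fan_triangle_unique[OF T' bc] by simp
    qed
  qed
  moreover have "path_edges n E {?l..} ?l (?f b) = b"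
  proof (rule path_edges_ccw[OF lab p b(1,3)])
    show "?f i \<in> {?l..}" if "i \<le> b" for i
      using above[of i] that b f0 by (cases "i = 0") auto
    show "b \<le> ?N - 1" "?N - 1 < ?N" using b by simp_all
    show "?f (?N - 1) \<notin> {?l..}" using below[of "?N - 1"] s by simp
  qed
  moreover have "path_edges n E {..?l} ?l (?f c) = ?N - c"
  proof (rule path_edges_cw[OF lab p c(3,2)])
    show "?f i \<in> {..?l}" if "c \<le> i" "i \<le> ?N" for i
      using below[of i] that c f0 by (cases "i = ?N") auto
    show "1 \<le> c" using c by simp
    show "?f 1 \<notin> {..?l}" using above[of 1] s by simp
  qed
  ultimately show ?thesis
    unfolding weight_def fan_product_eq[OF T' bc] by simp
qed

text \<open>The same with the two sides exchanged: now the labels below \<open>l\<close> come first.\<close>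

lemma weight_up:
  assumes T: "T \<in> triangulations (2*n+2)" and lab: "labelling n E" and p: "p < 2*n+2"
    and s: "0 < s" "s \<le> 2*n"
    and below: "\<And>j. 0 < j \<Longrightarrow> j < 2*n+2 \<Longrightarrow> label_from n E p j < vertex_label n E p \<longleftrightarrow> j \<le> s"
  shows "weight n E T (vertex_label n E p)
    = fan_product (2*n+2) (move (rotation (2*n+2) (2*n+2 - p)) T) s"
proof -
  let ?N = "2*n+2"
  let ?T = "move (rotation ?N (?N - p)) T" and ?f = "label_from n E p" and ?l = "vertex_label n E p"
  have T': "?T \<in> triangulations ?N"
    by (rule move_triangulation[OF polygon_symmetry_rotation T]) simp
  have sN: "s < ?N - 1" using s by simp
  obtain b c where bc: "fan_triangle ?N ?T s b c" using fan_triangle_exists[OF T' s(1) sN] by blast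
  have b: "0 < b" "b \<le> s" "b < ?N" and c: "s < c" "c < ?N" "0 < c"
    using bc unfolding fan_triangle_def by auto
  have above: "?l < ?f j \<longleftrightarrow> s < j" if "0 < j" "j < ?N" for j
  proof -
    have "?f j \<noteq> ?l" using label_from_eq_iff[OF lab p that(2), of 0] that p by (simp add: label_from_0)
    then show ?thesis using below[OF that] by auto
  qed
  have f0: "?f 0 = ?l" "?f ?N = ?l" using p unfolding label_from_def mod_add_self2 by simp_all
  have "middle_triangle n E T ?l = (?f b, ?f c)"
  proof (rule middle_triangle_eq[OF T lab p b(3) c(2)])
    show "{0, b, c} \<in> ?T" using bc unfolding fan_triangle_def by simp
    show "?f b < ?l" "?l < ?f c" using below[OF b(1,3)] above[OF c(3,2)] b c by simp_all
    show "i = b \<and> j = c" if "i < ?N" "j < ?N" "{0, i, j} \<in> ?T" "?f i < ?l" "?l < ?f j" for i j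
    proof -
      have pos: "0 < i" "0 < j" using that f0 by (auto intro: gr0I)
      then have "fan_triangle ?N ?T s i j"
        using that below[OF pos(1)] above[OF pos(2)] unfolding fan_triangle_def by simp
      then show ?thesis using fan_triangle_unique[OF T' bc] by simp
    qed
  qed
  moreover have "path_edges n E {..?l} ?l (?f b) = b"
  proof (rule path_edges_ccw[OF lab p b(1,3)])
    show "?f i \<in> {..?l}" if "i \<le> b" for i
      using below[of i] that b f0 by (cases "i = 0") auto
    show "b \<le> ?N - 1" "?N - 1 < ?N" using b by simp_all
    show "?f (?N - 1) \<notin> {..?l}" using above[of "?N - 1"] s by simp
  qed
  moreover have "path_edges n E {?l..} ?l (?f c) = ?N - c"
  proof (rule path_edges_cw[OF lab p c(3,2)])
    show "?f i \<in> {?l..}" if "c \<le> i" "i \<le> ?N" for i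
      using above[of i] that c f0 by (cases "i = ?N") auto
    show "1 \<le> c" using c by simp
    show "?f 1 \<notin> {?l..}" using below[of 1] s by simp
  qed
  ultimately show ?thesis
    unfolding weight_def fan_product_eq[OF T' bc] by simp
qed

section \<open>The labels along the boundary\<close>

lemma vertex_label_unimodal:
  obtains q where "labelling n E" "1 \<le> q" "q < 2*n+2" "vertex_label n E 0 = 0"
    "vertex_label n E q = 2*n+1"
    "\<And>i j. i < j \<Longrightarrow> j \<le> q \<Longrightarrow> vertex_label n E i < vertex_label n E j"
    "\<And>i j. q \<le> i \<Longrightarrow> i < j \<Longrightarrow> j < 2*n+2 \<Longrightarrow> vertex_label n E j < vertex_label n E i"
proof -
  let ?D = "down_elements n E" and ?U = "up_elements n E"
  define ds where "ds = sorted_list_of_set ?D"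
  define us where "us = rev (sorted_list_of_set ?U)"
  define ls where "ls = 0 # ds @ (2*n+1) # us"
  define q where "q = Suc (length ds)"
  have lab: "vertex_label n E = (!) ls"
    unfolding vertex_label_def ls_def ds_def us_def by (rule ext) simp
  have U: "?U \<subseteq> {1..2*n}" unfolding up_elements_def by auto
  have fin: "finite ?D" "finite ?U" using finite_subset[OF U] unfolding down_elements_def by auto
  have sets: "set ds = ?D" "set us = ?U" using fin unfolding ds_def us_def by auto
  have D: "?D \<subseteq> {1..2*n}" unfolding down_elements_def by auto
  have DU: "?D \<inter> ?U = {}" "?D \<union> ?U = {1..2*n}" using U unfolding down_elements_def by auto
  have "set ls = {..<2*n+2}"
  proof -
    have "set ls = insert 0 (insert (2*n+1) (?D \<union> ?U))" unfolding ls_def by (auto simp: sets)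
    then show ?thesis unfolding DU(2) by auto
  qed
  moreover have "distinct ls"
    unfolding ls_def using DU(1) D U sets by (auto simp: ds_def us_def)
  moreover have len: "length ls = 2*n+2"
    using calculation distinct_card[of ls] by simp
  ultimately have bij: "labelling n E"
    unfolding lab by (intro bij_betw_nth) (simp_all add: lessThan_atLeast0)
  have up: "sorted_wrt (<) (0 # ds @ [2*n+1])"
    using sets(1) D strict_sorted_list_of_set[of ?D]
    by (auto simp: ds_def sorted_wrt_append)
  have down: "sorted_wrt (>) ((2*n+1) # us)"
    using sets(2) U strict_sorted_list_of_set[of ?U]
    by (auto simp: us_def sorted_wrt_rev)
  have first: "ls ! i = (0 # ds @ [2*n+1]) ! i" if "i \<le> q" for i
    using that unfolding ls_def q_def by (auto simp: nth_Cons nth_append split: nat.split)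
  have last: "ls ! i = ((2*n+1) # us) ! (i - q)" if "q \<le> i" for i
    using that unfolding ls_def q_def by (auto simp: nth_Cons nth_append split: nat.split)
  have len': "length ls = q + Suc (length us)" unfolding ls_def q_def by simp
  show ?thesis
  proof (rule that[OF bij])
    show "1 \<le> q" "q < 2*n+2" using len len' unfolding q_def by simp_all
    show "vertex_label n E 0 = 0" unfolding lab ls_def by simp
    show "vertex_label n E q = 2*n+1" unfolding lab last[OF le_refl] by simp
    show "vertex_label n E i < vertex_label n E j" if "i < j" "j \<le> q" for i j
      using sorted_wrt_nth_less[OF up that(1)] that first[of i] first[of j]
      unfolding lab q_def by simp
    show "vertex_label n E j < vertex_label n E i" if "q \<le> i" "i < j" "j < 2*n+2" for i j
      using sorted_wrt_nth_less[OF down, of "i - q" "j - q"] that last[of i] last[of j] len len'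
      unfolding lab by simp
  qed
qed

text \<open>
  A downward closed subset of \<open>{1..<N}\<close> is determined by its cardinality, so it is enough to know
  in which order larger and smaller labels occur, not where the change takes place.
\<close>

lemma initial_segment_iff:
  fixes P :: "nat \<Rightarrow> bool"
  assumes closed: "\<And>i j. 0 < i \<Longrightarrow> i < j \<Longrightarrow> j < N \<Longrightarrow> P j \<Longrightarrow> P i"
    and card: "card {j. 0 < j \<and> j < N \<and> P j} = s" and j: "0 < j" "j < N"
  shows "P j \<longleftrightarrow> j \<le> s"
proof
  let ?A = "{j. 0 < j \<and> j < N \<and> P j}"
  have fin: "finite ?A" by simp
  assume Pj: "P j"
  have "{1..j} \<subseteq> ?A"
  proof
    fix i assume i: "i \<in> {1..j}"
    have "P i" using closed[of i j] i j Pj by (cases "i = j") simp_all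
    then show "i \<in> ?A" using i j by simp
  qed
  from card_mono[OF fin this] show "j \<le> s" using card by simp
next
  let ?A = "{j. 0 < j \<and> j < N \<and> P j}"
  assume "j \<le> s"
  show "P j"
  proof (rule ccontr)
    assume Pj: "\<not> P j"
    have "?A \<subseteq> {1..<j}"
    proof
      fix i assume i: "i \<in> ?A"
      have "i < j" using closed[of j i] i j Pj by (cases i j rule: linorder_cases) simp_all
      then show "i \<in> {1..<j}" using i by simp
    qed
    from card_mono[OF _ this] show False using card \<open>j \<le> s\<close> j by simp
  qed
qed

lemma card_labels_from:
  assumes lab: "labelling n E" and p: "p < 2*n+2" and not: "\<not> Q (vertex_label n E p)"
  shows "card {j. 0 < j \<and> j < 2*n+2 \<and> Q (label_from n E p j)} = card {m. m < 2*n+2 \<and> Q m}"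
proof -
  let ?f = "label_from n E p" and ?A = "{j. 0 < j \<and> j < 2*n+2 \<and> Q (label_from n E p j)}"
  have bij: "bij_betw ?f {..<2*n+2} {..<2*n+2}" using bij_betw_label_from[OF lab p] .
  have A: "?A = {j \<in> {..<2*n+2}. Q (?f j)}"
    using not label_from_0[OF p, of E] by (auto intro!: gr0I)
  have "?f ` ?A = {m. m < 2*n+2 \<and> Q m}"
    unfolding A using bij_betw_imp_surj_on[OF bij] by auto
  moreover have "inj_on ?f ?A"
    using inj_on_subset[OF bij_betw_imp_inj_on[OF bij], of ?A] by auto
  ultimately show ?thesis using card_image[of ?f ?A] by simp
qed

text \<open>
  The labels increase and then decrease along the boundary. Hence, going counterclockwise from
  the vertex labeled \<open>l\<close>, all larger labels precede all smaller ones if \<open>l\<close> lies on the increasing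
  part, and all smaller labels precede all larger ones if \<open>l\<close> lies on the decreasing part. There
  are \<open>2 * n + 1 - l\<close> larger and \<open>l\<close> smaller labels, which gives \<open>s\<close> in the two cases.
\<close>

lemma weight_eq_fan_product:
  assumes l: "1 \<le> l" "l \<le> 2*n"
  obtains p s where "p < 2*n+2" "1 \<le> s" "s \<le> 2*n"
    "\<And>T. T \<in> triangulations (2*n+2) \<Longrightarrow>
      weight n E T l = fan_product (2*n+2) (move (rotation (2*n+2) (2*n+2 - p)) T) s"
proof -
  let ?N = "2*n+2" and ?v = "vertex_label n E"
  obtain q where lab: "labelling n E" and q: "1 \<le> q" "q < ?N" and ends: "?v 0 = 0" "?v q = 2*n+1"
    and inc: "\<And>i j. i < j \<Longrightarrow> j \<le> q \<Longrightarrow> ?v i < ?v j"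
    and dec: "\<And>i j. q \<le> i \<Longrightarrow> i < j \<Longrightarrow> j < ?N \<Longrightarrow> ?v j < ?v i"
    by (rule vertex_label_unimodal[of n E], rule that; simp)
  have "l \<in> ?v ` {..<?N}" using bij_betw_imp_surj_on[OF lab] l by simp
  then obtain p where p: "p < ?N" "?v p = l" by auto
  have p0: "0 < p" "p \<noteq> q" using p ends l by (auto intro: gr0I)
  \<comment> \<open>Steps from \<open>p\<close> are compared as unreduced positions in \<open>{p..<p + N}\<close>, which pass \<open>0\<close> at \<open>N\<close>.\<close>
  have wrap: "label_from n E p j = (if p + j < ?N then ?v (p + j) else ?v (p + j - ?N))"
    if "j < ?N" for j
    using p(1) that unfolding label_from_def by (simp add: mod_if)
  show ?thesis
  proof (cases "p < q")
    case True
    have "label_from n E p j > l \<longleftrightarrow> j \<le> 2*n+1-l" if j: "0 < j" "j < ?N" for j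
    proof (rule initial_segment_iff[OF _ _ j])
      show "label_from n E p i > l"
        if ij: "0 < i" "i < j" "j < ?N" "label_from n E p j > l" for i j
      proof -
        have "p + j < ?N"
        proof (rule ccontr)
          assume "\<not> p + j < ?N"
          then have "label_from n E p j < l"
            using wrap[OF ij(3)] inc[of "p + j - ?N" p] ij(3) True p(2) by simp
          then show False using ij(4) by simp
        qed
        then have eq: "label_from n E p j = ?v (p + j)" "label_from n E p i = ?v (p + i)"
          using wrap ij by simp_all
        show ?thesis
        proof (cases "p + i \<le> q")
          case True
          then show ?thesis using inc[of p "p + i"] ij(1) p(2) eq by simp
        next
          case False
          then show ?thesis
            using dec[of "p + i" "p + j"] ij \<open>p + j < ?N\<close> eq by simp
        qed
      qed
      have "{m. m < ?N \<and> l < m} = {l<..<?N}" by auto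
      then show "card {j. 0 < j \<and> j < ?N \<and> l < label_from n E p j} = 2*n+1-l"
        using card_labels_from[OF lab p(1), of "\<lambda>m. l < m"] p(2) by simp
    qed
    then show ?thesis
      using weight_down[OF _ lab p(1), of _ "2*n+1-l"] p(2) l
      by (intro that[of p "2*n+1-l"]) (use p(1) in auto)
  next
    case False
    then have pq: "q < p" using p0 by simp
    have "label_from n E p j < l \<longleftrightarrow> j \<le> l" if j: "0 < j" "j < ?N" for j
    proof (rule initial_segment_iff[OF _ _ j])
      show "label_from n E p i < l"
        if ij: "0 < i" "i < j" "j < ?N" "label_from n E p j < l" for i j
      proof (cases "p + i < ?N")
        case True
        then show ?thesis using wrap[of i] ij dec[of p "p + i"] pq p(2) by simp
      next
        case out: False
        then have eq: "label_from n E p j = ?v (p + j - ?N)" "label_from n E p i = ?v (p + i - ?N)"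
          using wrap ij by simp_all
        have "p + j - ?N < q"
        proof (rule ccontr)
          assume "\<not> p + j - ?N < q"
          then have "q \<le> p + j - ?N" "p + j - ?N < p" using ij(3) p0(1) by linarith+
          from dec[OF this p(1)] show False using p(2) ij(4) eq(1) by simp
        qed
        moreover have "p + i - ?N < p + j - ?N" using ij out by linarith
        ultimately have "?v (p + i - ?N) < ?v (p + j - ?N)" by (intro inc) simp_all
        then show ?thesis using ij(4) eq by simp
      qed
      have "{m. m < ?N \<and> m < l} = {..<l}" using l by auto
      then show "card {j. 0 < j \<and> j < ?N \<and> label_from n E p j < l} = l"
        using card_labels_from[OF lab p(1), of "\<lambda>m. m < l"] p(2) by simp
    qed
    then show ?thesis
      using weight_up[OF _ lab p(1), of _ l] p(2) l
      by (intro that[of p l]) (use p(1) in auto)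
  qed
qed

section \<open>The center of gravity\<close>

text \<open>
  Rotating the vertex labeled \<open>l\<close> to \<open>0\<close> permutes the centrally symmetric triangulations, since
  rotations commute with the half turn; so the orientation disappears from the sum.
\<close>

lemma sum_weight:
  assumes "1 \<le> l" "l \<le> 2*n"
  shows "(\<Sum>T\<in>symmetric_triangulations n. real (weight n E T l))
    = (2 * real n + 1) / 2 * real (card (symmetric_triangulations n))"
proof -
  let ?S = "symmetric_triangulations n"
  obtain p s where p: "p < 2*n+2" and s: "1 \<le> s" "s \<le> 2*n"
    and w: "\<And>T. T \<in> triangulations (2*n+2) \<Longrightarrow>
      weight n E T l = fan_product (2*n+2) (move (rotation (2*n+2) (2*n+2 - p)) T) s"
    using weight_eq_fan_product[OF assms, of E] by metis
  let ?R = "move (rotation (2*n+2) (2*n+2 - p))"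
  have bij: "bij_betw ?R ?S ?S"
    by (intro bij_betw_move_symmetric polygon_symmetry_rotation half_turn_rotation) simp
  have "(\<Sum>T\<in>?S. real (weight n E T l)) = (\<Sum>T\<in>?S. real (fan_product (2*n+2) (?R T) s))"
    by (rule sum.cong[OF refl]) (simp only: w[OF symmetric_triangulation])
  also have "\<dots> = (\<Sum>T\<in>?S. real (fan_product (2*n+2) T s))"
    by (rule sum.reindex_bij_betw[OF bij])
  finally show ?thesis unfolding sum_fan_product[OF s] .
qed

text \<open>
  The mean \<open>(2 * n + 1) / 2\<close> of the weights is the fixed point of \<open>x \<mapsto> 2 * n + 1 - x\<close>, so up and down
  elements have the same mean coordinate.
\<close>

lemma sum_coordinate:
  assumes "1 \<le> l" "l \<le> 2*n"
  shows "(\<Sum>T\<in>symmetric_triangulations n. coordinate n E T l)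
    = (2 * real n + 1) / 2 * real (card (symmetric_triangulations n))"
  using sum_weight[OF assms, of E] unfolding coordinate_def
  by (cases "l \<in> up_elements n E") (auto simp: sum_subtractf field_simps)

theorem corollary4p1:
  fixes n :: nat and E :: "(nat \<times> nat) set" and \<iota> :: "'m::finite \<Rightarrow> nat" and G :: "real ^ 'm"
  assumes "n \<ge> 1"
    and "symmetric_orientation n E"
    and "bij_betw \<iota> UNIV {1..2*n}"
    and "G = (\<chi> i. (2 * real n + 1) / 2)"
  shows "cyclohedron_center n E \<iota> = G \<and>
    (\<Sum>T\<in>symmetric_triangulations n. M n E \<iota> T - G) = 0"
proof -
  let ?S = "symmetric_triangulations n"
  have fin: "finite ?S" using finite_triangulations unfolding symmetric_triangulations_def by simp
  have card: "real (card ?S) \<noteq> 0"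
    using symmetric_triangulations_nonempty[OF assms(1)] fin by simp
  have "(\<Sum>T\<in>?S. M n E \<iota> T) = real (card ?S) *\<^sub>R G"
  proof (rule vec_eq_iff[THEN iffD2], rule allI)
    fix i
    have "\<iota> i \<in> {1..2*n}" using bij_betwE[OF assms(3)] by simp
    then show "(\<Sum>T\<in>?S. M n E \<iota> T) $ i = (real (card ?S) *\<^sub>R G) $ i"
      using sum_coordinate[of "\<iota> i" n E] unfolding assms(4) M_def by (simp add: sum_component)
  qed
  then have sum: "(\<Sum>T\<in>?S. M n E \<iota> T - H) = real (card ?S) *\<^sub>R (G - H)" for H
    by (simp add: sum_subtractf scaleR_diff_right sum_constant_scaleR del: sum_constant)
  have "cyclohedron_center n E \<iota> = G"
    unfolding cyclohedron_center_def sum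
    by (rule the_equality) (use card in auto)
  moreover have "(\<Sum>T\<in>?S. M n E \<iota> T - G) = 0" unfolding sum by simp
  ultimately show ?thesis by (rule conjI)
qed

end
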